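(* For Hausdorff topological groups the classes of SIN groups, SFSIN groups and FSIN groups coincide: $[\mathrm{SIN}]=[\mathrm{SFSIN}]=[\mathrm{FSIN}]$. That is, for a Hausdorff topological group $G$ the following are equivalent: $G$ is SIN; $G$ is SFSIN; $G$ is FSIN.
   Context: For a topological group $G$ with identity $e$, the left uniformity is generated by the sets $\{(x,y): x^{-1}y\in U\}$ and the right uniformity by the sets $\{(x,y): xy^{-1}\in U\}$, where $U$ ranges over the neighbourhoods of $e$. A function $G\to\mathbb R$ is left (right) uniformly continuous if it is uniformly continuous with respect to the left (right) uniformity and the usual uniformity on $\mathbb R$. $G$ is SIN (balanced) if the left and right uniformities coincide. $G$ is FSIN (functionally balanced) if every bounded real-valued left uniformly continuous function on $G$ is right uniformly continuous. $G$ is SFSIN (strongly functionally balanced) if every (not necessarily bounded) real-valued left uniformly continuous function on $G$ is right uniformly continuous. *)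

theory Defs
  imports "HOL-Analysis.Analysis"
begin

(* The class topological_group_add is the library's notion of an arbitrary topological group:
   it is not assumed commutative, and it is written additively. So 0 is the identity e,
   - x + y is the element x^{-1} y, and x + (- y) is the element x y^{-1}.
   A uniformity is represented by the filter of its entourages, as in class uniform_space. *)

definition left_uniformity :: "('a::topological_group_add \<times> 'a) filter" where
  "left_uniformity =
     (INF U \<in> {U. \<exists>V. open V \<and> 0 \<in> V \<and> V \<subseteq> U}. principal {(x, y). - x + y \<in> U})"

definition right_uniformity :: "('a::topological_group_add \<times> 'a) filter" where
  "right_uniformity =
     (INF U \<in> {U. \<exists>V. open V \<and> 0 \<in> V \<and> V \<subseteq> U}. principal {(x, y). x + (- y) \<in> U})"

(* These follow the library's definition of uniformly_continuous_on, which is tied to the one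
   uniformity of the class uniform_space; here the uniformity on the domain is explicit. *)

definition left_uniformly_continuous :: "('a::topological_group_add \<Rightarrow> real) \<Rightarrow> bool" where
  "left_uniformly_continuous f \<longleftrightarrow> (LIM (x, y) left_uniformity. (f x, f y) :> uniformity)"

definition right_uniformly_continuous :: "('a::topological_group_add \<Rightarrow> real) \<Rightarrow> bool" where
  "right_uniformly_continuous f \<longleftrightarrow> (LIM (x, y) right_uniformity. (f x, f y) :> uniformity)"

definition SIN :: "'a::topological_group_add itself \<Rightarrow> bool" where
  "SIN (G :: 'a itself) \<longleftrightarrow> (left_uniformity :: ('a \<times> 'a) filter) = right_uniformity"

definition FSIN :: "'a::topological_group_add itself \<Rightarrow> bool" where
  "FSIN (G :: 'a itself) \<longleftrightarrow>
     (\<forall>f :: 'a \<Rightarrow> real. bounded (range f) \<and> left_uniformly_continuous f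
        \<longrightarrow> right_uniformly_continuous f)"

definition SFSIN :: "'a::topological_group_add itself \<Rightarrow> bool" where
  "SFSIN (G :: 'a itself) \<longleftrightarrow>
     (\<forall>f :: 'a \<Rightarrow> real. left_uniformly_continuous f \<longrightarrow> right_uniformly_continuous f)"

end

theory Submission
  imports Defs
begin

text \<open>
  Only FSIN implies SIN needs an argument; write the group multiplicatively. Applied to the distance
  from a set \<open>A\<close> in a left invariant pseudometric, FSIN says that for all \<open>A\<close> and \<open>U\<close> there is a
  neighbourhood \<open>V\<close> with \<open>V A \<subseteq> A U\<close>. If the same were known for \<open>G \<times> G\<close> and the diagonal action,
  one could take a maximal left uniformly separated set \<open>D\<close> and a well-order on \<open>D\<close> as the subset of
  \<open>G \<times> G\<close>: elements close to the identity would then permute \<open>D\<close> up to a small error while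
  preserving the well-order, hence fix \<open>D\<close> up to a small error, and that is SIN.

  To pass from \<open>G\<close> to \<open>G \<times> G\<close>, note that a set \<open>T\<close> with \<open>t' \<notin> W t W\<close> for distinct \<open>t, t' \<in> T\<close> satisfies
  \<open>t\<^sup>-\<^sup>1 L t \<subseteq> W\<close> uniformly in \<open>t\<close>, for some neighbourhood \<open>L\<close>. With \<open>T\<close> maximal, every pair is close
  to \<open>(a, a t)\<close> for some \<open>t \<in> T\<close>, and the pair can be moved along with \<open>a\<close> provided that \<open>t\<close> can be
  recovered from \<open>a\<close>. This is achieved by replacing \<open>a\<close> with \<open>b\<close>, where \<open>b s\<close> is close to \<open>a\<close> and
  \<open>s\<close> ranges over another such set \<open>S\<close>. Only one \<open>b\<close> is needed for each \<open>t\<close> and each member of a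
  two-sided net of least cardinality, and this minimality leaves enough room to choose the elements
  \<open>b\<close> two-sided separated from each other by transfinite recursion.
\<close>

unbundle cardinal_syntax

section \<open>Symmetric neighbourhoods of the identity\<close>

definition sym_nhd :: "'a::topological_group_add set \<Rightarrow> bool" where
  "sym_nhd W \<longleftrightarrow> (\<forall>\<^sub>F x in nhds 0. x \<in> W) \<and> (\<forall>x\<in>W. - x \<in> W)"

lemma sym_nhd_eventually: "sym_nhd W \<Longrightarrow> \<forall>\<^sub>F x in nhds 0. x \<in> W"
  and sym_nhd_minus: "sym_nhd W \<Longrightarrow> x \<in> W \<Longrightarrow> - x \<in> W"
  by (auto simp: sym_nhd_def)

lemma sym_nhd_zero: "sym_nhd W \<Longrightarrow> 0 \<in> W"
  by (auto simp: sym_nhd_def dest: eventually_nhds_x_imp_x)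

lemma sym_nhd_UNIV: "sym_nhd UNIV"
  by (simp add: sym_nhd_def)

lemma sym_nhd_Int: "sym_nhd V \<Longrightarrow> sym_nhd W \<Longrightarrow> sym_nhd (V \<inter> W)"
  by (auto simp: sym_nhd_def eventually_conj)

lemma sym_nhd_INT: "finite C \<Longrightarrow> (\<And>c. c \<in> C \<Longrightarrow> sym_nhd (V c)) \<Longrightarrow> sym_nhd (\<Inter>c\<in>C. V c)"
  by (induction C rule: finite_induct) (auto simp: sym_nhd_UNIV sym_nhd_Int)

lemma sym_nhd_subset:
  fixes U :: "'a::topological_group_add set"
  assumes "\<forall>\<^sub>F x in nhds 0. x \<in> U"
  obtains W where "sym_nhd W" "W \<subseteq> U"
proof -
  have "\<forall>\<^sub>F x::'a in nhds 0. - x \<in> U"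
    using tendsto_uminus_nhds[of "0::'a"] assms by (auto simp: filterlim_iff)
  then have "sym_nhd (U \<inter> uminus -` U)"
    using assms by (auto simp: sym_nhd_def eventually_conj)
  then show thesis
    using that by blast
qed

lemma sym_nhd_half:
  fixes U :: "'a::topological_group_add set"
  assumes "\<forall>\<^sub>F x in nhds 0. x \<in> U"
  obtains W where "sym_nhd W" "W \<subseteq> U" "\<And>x y. x \<in> W \<Longrightarrow> y \<in> W \<Longrightarrow> x + y \<in> U"
proof -
  have "\<forall>\<^sub>F z in nhds (0::'a) \<times>\<^sub>F nhds 0. fst z + snd z \<in> U"
    using tendsto_add_Pair[of "0::'a" 0] assms by (auto simp: filterlim_iff)
  then obtain P where P: "\<forall>\<^sub>F x in nhds (0::'a). P x" "\<And>x y. P x \<Longrightarrow> P y \<Longrightarrow> x + y \<in> U"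
    by (auto simp: eventually_prod_same)
  with assms have "\<forall>\<^sub>F x in nhds 0. x \<in> Collect P \<inter> U"
    by (simp add: eventually_conj)
  then obtain W where "sym_nhd W" "W \<subseteq> Collect P \<inter> U"
    by (rule sym_nhd_subset)
  then show thesis
    using that P(2) by blast
qed

lemma sym_nhd_third:
  fixes U :: "'a::topological_group_add set"
  assumes "\<forall>\<^sub>F x in nhds 0. x \<in> U"
  obtains W where "sym_nhd W" "W \<subseteq> U"
    "\<And>x y. x \<in> W \<Longrightarrow> y \<in> W \<Longrightarrow> x + y \<in> U"
    "\<And>x y z. x \<in> W \<Longrightarrow> y \<in> W \<Longrightarrow> z \<in> W \<Longrightarrow> x + y + z \<in> U"
proof -
  obtain V where V: "sym_nhd V" "V \<subseteq> U" "\<And>x y. x \<in> V \<Longrightarrow> y \<in> V \<Longrightarrow> x + y \<in> U"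
    using sym_nhd_half[OF assms] by blast
  obtain W where W: "sym_nhd W" "W \<subseteq> V" "\<And>x y. x \<in> W \<Longrightarrow> y \<in> W \<Longrightarrow> x + y \<in> V"
    using sym_nhd_half[OF sym_nhd_eventually[OF V(1)]] by blast
  show thesis
    by (rule that[of W]) (use V W in blast)+
qed

section \<open>The two uniformities in terms of symmetric neighbourhoods\<close>

lemma left_uniformity_le:
  assumes "\<forall>\<^sub>F x in nhds 0. x \<in> U"
  shows "left_uniformity \<le> principal {(x, y). - x + y \<in> U}"
  unfolding left_uniformity_def
  by (rule INF_lower) (use assms in \<open>auto simp: eventually_nhds\<close>)

lemma right_uniformity_le:
  assumes "\<forall>\<^sub>F x in nhds 0. x \<in> U"
  shows "right_uniformity \<le> principal {(x, y). x + (- y) \<in> U}"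
  unfolding right_uniformity_def
  by (rule INF_lower) (use assms in \<open>auto simp: eventually_nhds\<close>)

lemma eventually_right_uniformityD:
  fixes P :: "'a::topological_group_add \<times> 'a \<Rightarrow> bool"
  assumes "eventually P right_uniformity"
  obtains V where "sym_nhd V" "\<And>x y. x + (- y) \<in> V \<Longrightarrow> P (x, y)"
proof -
  let ?B = "{U::'a set. \<exists>V. open V \<and> 0 \<in> V \<and> V \<subseteq> U}"
  have B: "U \<in> ?B \<longleftrightarrow> (\<forall>\<^sub>F x in nhds 0. x \<in> U)" for U
    by (auto simp: eventually_nhds)
  have "\<exists>U\<in>?B. eventually P (principal {(x, y). x + (- y) \<in> U})"
  proof (rule iffD1[OF eventually_INF_base])
    show "?B \<noteq> {}" by auto
    show "\<exists>W\<in>?B. principal {(x, y). x + (- y) \<in> W}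
        \<le> inf (principal {(x, y). x + (- y) \<in> U}) (principal {(x, y). x + (- y) \<in> U'})"
      if "U \<in> ?B" "U' \<in> ?B" for U U'
    proof (rule bexI)
      show "U \<inter> U' \<in> ?B"
        using that unfolding B by (simp add: eventually_conj)
    qed auto
    show "eventually P (INF U\<in>?B. principal {(x, y). x + (- y) \<in> U})"
      using assms unfolding right_uniformity_def .
  qed
  then obtain U where U: "U \<in> ?B" "\<And>x y. x + (- y) \<in> U \<Longrightarrow> P (x, y)"
    unfolding eventually_principal by blast
  obtain V where "sym_nhd V" "V \<subseteq> U"
    using sym_nhd_subset U(1) unfolding B by blast
  then show thesis
    using U(2) that by blast
qed

text \<open>The element \<open>x + (- y)\<close> is the conjugate by \<open>- x\<close> of
  \<open>- y + x\<close>, the inverse of \<open>- x + y\<close>. Hence a bound on conjugates that is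
  uniform in \<open>x\<close> turns entourages of either uniformity into entourages of the
  other.\<close>

lemma SIN_if_conjugates_small:
  assumes "\<And>U :: 'a::topological_group_add set. \<forall>\<^sub>F x in nhds 0. x \<in> U
    \<Longrightarrow> \<exists>V. sym_nhd V \<and> (\<forall>v\<in>V. \<forall>x. - x + v + x \<in> U)"
  shows "SIN TYPE('a)"
  unfolding SIN_def
proof (rule antisym)
  show "(left_uniformity :: ('a \<times> 'a) filter) \<le> right_uniformity"
    unfolding right_uniformity_def
  proof (rule INF_greatest)
    fix U :: "'a set" assume "U \<in> {U. \<exists>V. open V \<and> 0 \<in> V \<and> V \<subseteq> U}"
    then have "\<forall>\<^sub>F x in nhds 0. x \<in> U"
      by (auto simp: eventually_nhds)
    then obtain V where V: "sym_nhd V" "\<And>v x. v \<in> V \<Longrightarrow> - x + v + x \<in> U"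
      using assms by blast
    have "x + (- y) \<in> U" if "- x + y \<in> V" for x y
      using V(2)[OF sym_nhd_minus[OF V(1) that], of "- x"] by (simp add: minus_add add.assoc del: add_uminus_conv_diff)
    then show "left_uniformity \<le> principal {(x, y). x + (- y) \<in> U}"
      by (intro order_trans[OF left_uniformity_le[OF sym_nhd_eventually[OF V(1)]]]) auto
  qed
  show "(right_uniformity :: ('a \<times> 'a) filter) \<le> left_uniformity"
    unfolding left_uniformity_def
  proof (rule INF_greatest)
    fix U :: "'a set" assume "U \<in> {U. \<exists>V. open V \<and> 0 \<in> V \<and> V \<subseteq> U}"
    then have "\<forall>\<^sub>F x in nhds 0. x \<in> U"
      by (auto simp: eventually_nhds)
    then obtain V where V: "sym_nhd V" "\<And>v x. v \<in> V \<Longrightarrow> - x + v + x \<in> U"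
      using assms by blast
    have "- x + y \<in> U" if "x + (- y) \<in> V" for x y
      using V(2)[OF sym_nhd_minus[OF V(1) that], of x] by (simp add: minus_add add.assoc del: add_uminus_conv_diff)
    then show "right_uniformity \<le> principal {(x, y). - x + y \<in> U}"
      by (intro order_trans[OF right_uniformity_le[OF sym_nhd_eventually[OF V(1)]]]) auto
  qed
qed

section \<open>Separated sets and transfinite choice\<close>

lemma exists_maximal_separated:
  fixes r :: "'b \<Rightarrow> 'b \<Rightarrow> bool"
  assumes refl: "\<And>x. r x x" and sym: "\<And>x y. r x y \<Longrightarrow> r y x"
  obtains D where "\<And>x y. x \<in> D \<Longrightarrow> y \<in> D \<Longrightarrow> r x y \<Longrightarrow> x = y" "\<And>y. \<exists>x\<in>D. r x y"
proof -
  let ?S = "{D. \<forall>x\<in>D. \<forall>y\<in>D. r x y \<longrightarrow> x = y}"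
  have "\<exists>D\<in>?S. \<forall>X\<in>?S. D \<subseteq> X \<longrightarrow> X = D"
  proof (rule subset_Zorn')
    fix C assume C: "subset.chain ?S C"
    show "\<Union>C \<in> ?S"
    proof clarsimp
      fix x y X Y assume *: "x \<in> X" "X \<in> C" "y \<in> Y" "Y \<in> C" "r x y"
      have "X \<subseteq> Y \<or> Y \<subseteq> X" "C \<subseteq> ?S"
        using C * by (simp_all only: subset_chain_def)
      with * have "X \<in> ?S" "Y \<in> ?S" by (auto dest: subsetD)
      with \<open>X \<subseteq> Y \<or> Y \<subseteq> X\<close> show "x = y"
        using *(1,3,5) by auto
    qed
  qed
  then obtain D where D: "D \<in> ?S" "\<forall>X\<in>?S. D \<subseteq> X \<longrightarrow> X = D"
    by (rule bexE)
  have "\<exists>x\<in>D. r x y" for y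
  proof (rule ccontr)
    assume *: "\<not> (\<exists>x\<in>D. r x y)"
    then have "insert y D \<in> ?S"
      using D(1) sym by auto
    then have "insert y D = D"
      using D(2)[rule_format, of "insert y D"] by blast
    then show False
      using * refl by blast
  qed
  then show thesis
    using that D(1) by blast
qed

text \<open>Transfinite recursion: at each stage fewer than \<open>|I|\<close> elements have been
  chosen, so \<open>avail\<close> supplies one that is near none of them.\<close>

lemma greedy_separated_choice:
  fixes opt :: "'i \<Rightarrow> 'b set" and near :: "'b \<Rightarrow> 'b \<Rightarrow> bool"
  assumes sym: "\<And>x y. near x y \<Longrightarrow> near y x"
    and avail: "\<And>i B. i \<in> I \<Longrightarrow> |B| <o |I| \<Longrightarrow> \<exists>b\<in>opt i. \<forall>c\<in>B. \<not> near c b"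
  obtains \<beta> where "\<And>i. i \<in> I \<Longrightarrow> \<beta> i \<in> opt i"
    "\<And>i j. i \<in> I \<Longrightarrow> j \<in> I \<Longrightarrow> near (\<beta> i) (\<beta> j) \<Longrightarrow> i = j"
proof -
  \<comment> \<open>A well-order of least possible type, so that every proper initial segment
    \<open>underS r i\<close> is smaller than \<open>I\<close>.\<close>
  define r where "r = card_of I"
  have wo: "well_order_on I r"
    unfolding r_def by (rule card_of_well_order_on)
  define P where "P f i b \<longleftrightarrow> (i \<in> I \<longrightarrow> b \<in> opt i \<and> (\<forall>j\<in>underS r i. \<not> near (f j) b))"
    for f :: "'i \<Rightarrow> 'b" and i b
  have "\<exists>f. \<forall>i. P f i (f i)"
  proof (rule dependent_wf_choice)
    show "wf (r - Id)"
      using wo by (simp add: well_order_on_def)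
    show "P f i b = P g i b" if "\<And>z. (z, i) \<in> r - Id \<Longrightarrow> f z = g z" for f g i b
      using that by (auto simp: P_def underS_def)
    show "\<exists>b. P f i b" for i f
    proof (cases "i \<in> I")
      case True
      then have "|underS r i| <o r"
        unfolding r_def by (intro card_of_underS card_of_Card_order) (simp add: Field_card_of)
      then have "|f ` underS r i| <o |I|"
        unfolding r_def by (rule ordLeq_ordLess_trans[OF card_of_image])
      then show ?thesis
        using avail[OF True, of "f ` underS r i"] True by (auto simp: P_def r_def)
    qed (simp add: P_def)
  qed
  then obtain f where "\<And>i. P f i (f i)"
    by blast
  then have f: "\<And>i. i \<in> I \<Longrightarrow> f i \<in> opt i"
    "\<And>i j. i \<in> I \<Longrightarrow> j \<in> underS r i \<Longrightarrow> \<not> near (f j) (f i)"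
    unfolding P_def by blast+
  have "i = j" if "i \<in> I" "j \<in> I" "near (f i) (f j)" for i j
  proof (rule ccontr)
    assume "i \<noteq> j"
    with that wo have "i \<in> underS r j \<or> j \<in> underS r i"
      by (auto simp: underS_def well_order_on_def linear_order_on_def total_on_def)
    then show False
      using f(2) that sym by blast
  qed
  then show thesis
    using that f(1) by blast
qed

section \<open>Absorption of small left translations\<close>

text \<open>The entry \<open>p\<close> is the one at which the partial sums pass \<open>h\<close>.
  With \<open>h\<close> half of the total, neither \<open>as\<close> nor \<open>bs\<close> carries
  more than half of the weight.\<close>

lemma sum_list_split_at:
  fixes w :: "'b \<Rightarrow> real"
  assumes "0 \<le> h" "h < sum_list (map w ps)"
  shows "\<exists>as p bs. ps = as @ p # bs \<and> sum_list (map w as) \<le> h \<and> h < sum_list (map w as) + w p"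
  using assms
proof (induction ps arbitrary: h)
  case (Cons q ps)
  show ?case
  proof (cases "h < w q")
    case True
    then show ?thesis
      using Cons.prems by (intro exI[of _ "[]"] exI[of _ q] exI[of _ ps]) simp
  next
    case False
    then obtain as p bs where "ps = as @ p # bs" "sum_list (map w as) \<le> h - w q"
      "h - w q < sum_list (map w as) + w p"
      using Cons.IH[of "h - w q"] Cons.prems by auto
    then show ?thesis
      by (intro exI[of _ "q # as"] exI[of _ p] exI[of _ bs]) simp
  qed
qed simp

text \<open>Splitting at half of the weight leaves two shorter lists of weight below
  \<open>(1/2) ^ Suc n\<close>, whose sums lie in \<open>C (Suc n)\<close> by induction. The middle
  entry has weight below \<open>(1/2) ^ n\<close>, hence index at least \<open>Suc n\<close>, and
  \<open>third\<close> combines the three.\<close>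

lemma sum_list_mem_chain:
  fixes C :: "nat \<Rightarrow> 'a::monoid_add set"
  assumes zero: "\<And>n. 0 \<in> C n"
    and third: "\<And>n x y z. x \<in> C (Suc n) \<Longrightarrow> y \<in> C (Suc n) \<Longrightarrow> z \<in> C (Suc n) \<Longrightarrow> x + y + z \<in> C n"
    and "\<forall>p\<in>set ps. snd p \<in> C (fst p)"
    and "(\<Sum>p\<leftarrow>ps. (1/2::real) ^ fst p) < (1/2) ^ n"
  shows "sum_list (map snd ps) \<in> C n"
  using assms(3,4)
proof (induction ps arbitrary: n rule: length_induct)
  case (1 ps)
  let ?w = "\<lambda>ps. \<Sum>p\<leftarrow>ps. (1/2::real) ^ fst p"
  have nonneg: "0 \<le> ?w qs" for qs :: "(nat \<times> 'a) list"
    by (rule sum_list_nonneg) auto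
  have antimono: "C j \<subseteq> C i" if "i \<le> j" for i j
    by (rule lift_Suc_antimono_le[OF _ that]) (use third[OF _ zero zero] in auto)
  show ?case
  proof (cases "ps = []")
    case False
    then have "0 < ?w ps"
      using nonneg by (cases ps) (auto intro: add_pos_nonneg)
    then obtain as p bs where ps: "ps = as @ p # bs" and as: "?w as \<le> ?w ps / 2"
      and p: "?w ps / 2 < ?w as + (1/2) ^ fst p"
      using sum_list_split_at[of "?w ps / 2" "\<lambda>p. (1/2::real) ^ fst p" ps] by auto
    have "sum_list (map snd as) \<in> C (Suc n)" "sum_list (map snd bs) \<in> C (Suc n)"
      using 1 ps as p by auto
    moreover have "?w ps = ?w as + ((1/2) ^ fst p + ?w bs)"
      by (simp add: ps)
    then have "(1/2::real) ^ fst p < (1/2) ^ n"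
      using 1(3) nonneg[of as] nonneg[of bs] by linarith
    then have "Suc n \<le> fst p"
      by (simp add: Suc_le_eq)
    then have "snd p \<in> C (Suc n)"
      using antimono 1(2) ps by auto
    ultimately show ?thesis
      using third ps by (simp add: add.assoc)
  qed (simp add: zero)
qed

text \<open>The construction of Birkhoff and Kakutani, without symmetrisation.\<close>

lemma exists_subadditive:
  fixes U :: "'a::topological_group_add set"
  assumes "\<forall>\<^sub>F x in nhds 0. x \<in> U"
  obtains N :: "'a \<Rightarrow> real"
  where "\<And>x. 0 \<le> N x" "\<And>x. N x \<le> 1" "\<And>x y. N (x + y) \<le> N x + N y"
    "\<And>x. N x < 1/2 \<Longrightarrow> x \<in> U" "\<And>e. 0 < e \<Longrightarrow> \<forall>\<^sub>F x in nhds 0. N x < e"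
proof -
  obtain W0 where W0: "sym_nhd W0" "W0 \<subseteq> U"
    by (rule sym_nhd_subset[OF assms])
  have "\<exists>W. \<forall>n. (sym_nhd (W n) \<and> (n = 0 \<longrightarrow> W n \<subseteq> U)) \<and>
      (\<forall>x\<in>W (Suc n). \<forall>y\<in>W (Suc n). \<forall>z\<in>W (Suc n). x + y + z \<in> W n)"
    (is "\<exists>W. \<forall>n. ?P n (W n) \<and> ?Q (W n) (W (Suc n))")
  proof (rule dependent_nat_choice)
    show "\<exists>W. ?P 0 W"
      using W0 by blast
    show "\<exists>W'. ?P (Suc n) W' \<and> ?Q W W'" if "?P n W" for W n
    proof -
      obtain W' where "sym_nhd W'" "\<And>x y z. x \<in> W' \<Longrightarrow> y \<in> W' \<Longrightarrow> z \<in> W' \<Longrightarrow> x + y + z \<in> W"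
        using sym_nhd_third[OF sym_nhd_eventually] \<open>?P n W\<close> by metis
      then show ?thesis
        by blast
    qed
  qed
  then obtain W where PQ: "\<forall>n. ?P n (W n) \<and> ?Q (W n) (W (Suc n))"
    by (rule exE)
  then have W: "\<And>n. sym_nhd (W n)" "W 0 \<subseteq> U"
    "\<And>n x y z. x \<in> W (Suc n) \<Longrightarrow> y \<in> W (Suc n) \<Longrightarrow> z \<in> W (Suc n) \<Longrightarrow> x + y + z \<in> W n"
    by simp_all
  \<comment> \<open>The shift makes every element a summand of cost 1, so each \<open>S x\<close> is
    nonempty and \<open>N\<close> is at most 1. The threshold 1/2 then corresponds to
    \<open>C 1 = W 0\<close>.\<close>
  define C where "C n = (case n of 0 \<Rightarrow> UNIV | Suc n \<Rightarrow> W n)" for n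
  have C: "sym_nhd (C n)" for n
    by (simp add: C_def W(1) sym_nhd_UNIV split: nat.split)
  have C3: "x + y + z \<in> C n" if "x \<in> C (Suc n)" "y \<in> C (Suc n)" "z \<in> C (Suc n)" for n x y z
    using that W(3) by (cases n) (auto simp: C_def)
  define w :: "(nat \<times> 'a) list \<Rightarrow> real" where "w ps = (\<Sum>p\<leftarrow>ps. (1/2) ^ fst p)" for ps
  define S where "S x = {w ps | ps. (\<forall>p\<in>set ps. snd p \<in> C (fst p)) \<and> sum_list (map snd ps) = x}" for x
  define N where "N x = Inf (S x)" for x
  have single: "(1/2) ^ n \<in> S x" if "x \<in> C n" for n x
    using that by (auto simp: S_def w_def intro!: exI[of _ "[(n, x)]"])
  have S1: "1 \<in> S x" for x
    using single[of x 0] by (simp add: C_def)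
  have S0: "0 \<le> s" if "s \<in> S x" for s x
    using that by (auto simp: S_def w_def intro!: sum_list_nonneg)
  have bdd: "bdd_below (S x)" for x
    by (rule bdd_belowI) (rule S0)
  have N_le: "N x \<le> s" if "s \<in> S x" for s x
    unfolding N_def using that bdd by (rule cInf_lower)
  have S_add: "s + t \<in> S (x + y)" if st: "s \<in> S x" "t \<in> S y" for s t x y
  proof -
    obtain ps qs where "s = w ps" "t = w qs" "\<forall>p\<in>set ps. snd p \<in> C (fst p)"
      "\<forall>p\<in>set qs. snd p \<in> C (fst p)" "sum_list (map snd ps) = x" "sum_list (map snd qs) = y"
      using st unfolding S_def by blast
    then show ?thesis
      unfolding S_def by (intro CollectI exI[of _ "ps @ qs"]) (auto simp: w_def)
  qed
  show thesis
  proof (rule that[of N])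
    show "0 \<le> N x" for x
      unfolding N_def using S1 S0 by (intro cInf_greatest) blast+
    show "N x \<le> 1" for x
      by (rule N_le[OF S1])
    show "N (x + y) \<le> N x + N y" for x y
    proof -
      have "N (x + y) - t \<le> N x" if "t \<in> S y" for t
        unfolding N_def[of x]
      proof (rule cInf_greatest)
        show "S x \<noteq> {}"
          using S1 by blast
        show "N (x + y) - t \<le> s" if "s \<in> S x" for s
          using N_le[OF S_add[OF that \<open>t \<in> S y\<close>]] by simp
      qed
      then have "N (x + y) - N x \<le> N y"
        unfolding N_def[of y] using S1 by (intro cInf_greatest) (auto simp: algebra_simps)
      then show ?thesis
        by simp
    qed
    show "x \<in> U" if "N x < 1/2" for x
    proof -
      obtain s where "s \<in> S x" "s < 1/2"
        using \<open>N x < 1/2\<close> S1 cInf_lessD unfolding N_def by blast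
      then obtain ps where "\<forall>p\<in>set ps. snd p \<in> C (fst p)" "sum_list (map snd ps) = x" "w ps < (1/2) ^ 1"
        unfolding S_def by auto
      then have "x \<in> C 1"
        using sum_list_mem_chain[of C ps 1] sym_nhd_zero[OF C] C3 unfolding w_def by blast
      then show ?thesis
        using W(2) by (auto simp: C_def)
    qed
    show "\<forall>\<^sub>F x in nhds 0. N x < e" if "0 < e" for e
    proof -
      obtain n where n: "(1/2) ^ n < e"
        using \<open>0 < e\<close> real_arch_pow_inv[of e "1/2"] by auto
      show ?thesis
        using sym_nhd_eventually[OF C[of n]]
        by eventually_elim (use N_le[OF single] n in fastforce)
    qed
  qed
qed

text \<open>The function \<open>f\<close> vanishes on \<open>A\<close> and is left uniformly
  continuous by subadditivity of \<open>N\<close>. Right uniform continuity keeps it below 1/2 at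
  \<open>v + a\<close>, and an \<open>a'\<close> nearly attaining the infimum there is the one
  sought.\<close>

lemma FSIN_absorption:
  fixes U A :: "'a::topological_group_add set"
  assumes "FSIN TYPE('a)" and "\<forall>\<^sub>F x in nhds 0. x \<in> U"
  obtains V where "sym_nhd V" "\<And>v a. v \<in> V \<Longrightarrow> a \<in> A \<Longrightarrow> \<exists>a'\<in>A. - a' + v + a \<in> U"
proof (cases "A = {}")
  case True
  then show thesis
    using that[of UNIV] by (simp add: sym_nhd_UNIV)
next
  case False
  obtain N :: "'a \<Rightarrow> real" where N: "\<And>x. 0 \<le> N x" "\<And>x. N x \<le> 1" "\<And>x y. N (x + y) \<le> N x + N y"
    "\<And>x. N x < 1/2 \<Longrightarrow> x \<in> U" "\<And>e. 0 < e \<Longrightarrow> \<forall>\<^sub>F x in nhds 0. N x < e"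
    using exists_subadditive[OF assms(2)] by metis
  have N0: "N 0 = 0"
    using N(1)[of 0] eventually_nhds_x_imp_x[OF N(5)] by (metis less_irrefl order_le_less)
  define f where "f g = (INF a\<in>A. N (- a + g))" for g
  have bdd: "bdd_below ((\<lambda>a. N (- a + g)) ` A)" for g
    using N(1) by (auto intro!: bdd_belowI)
  have f_le: "f g \<le> N (- a + g)" if "a \<in> A" for a g
    unfolding f_def using bdd that by (rule cINF_lower)
  have f_nonneg: "0 \<le> f g" for g
    unfolding f_def using False N(1) by (intro cINF_greatest) auto
  have f_step: "f h \<le> f g + N (- g + h)" for g h
  proof -
    have "f h - N (- g + h) \<le> f g"
      unfolding f_def[of g]
    proof (rule cINF_greatest[OF False])
      fix a assume "a \<in> A"
      have "N (- a + h) \<le> N (- a + g) + N (- g + h)"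
        using N(3)[of "- a + g" "- g + h"] by (simp add: add.assoc)
      then show "f h - N (- g + h) \<le> N (- a + g)"
        using f_le[OF \<open>a \<in> A\<close>, of h] by simp
    qed
    then show ?thesis
      by simp
  qed
  have "bounded (range f)"
  proof (rule boundedI)
    fix r assume "r \<in> range f"
    then obtain g where r: "r = f g"
      by blast
    obtain a where "a \<in> A"
      using False by blast
    then have "f g \<le> 1"
      using f_le N(2) order_trans by blast
    then show "norm r \<le> 1"
      using f_nonneg r by simp
  qed
  moreover have "left_uniformly_continuous f"
    unfolding left_uniformly_continuous_def uniformity_dist filterlim_INF filterlim_principal
  proof
    fix e :: real assume "e \<in> {0<..}"
    then have "\<forall>\<^sub>F x in nhds 0. x \<in> {x. N x < e}"
      using N(5) by simp
    \<comment> \<open>As \<open>N\<close> need not be even, \<open>W\<close> is taken symmetric: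
      this bounds \<open>N\<close> at both \<open>- x + y\<close> and \<open>- y + x\<close>, so
      \<open>f_step\<close> applies in both directions.\<close>
    then obtain W where W: "sym_nhd W" "W \<subseteq> {x. N x < e}"
      by (rule sym_nhd_subset)
    have "dist (f x) (f y) < e" if xy: "- x + y \<in> W" for x y
    proof -
      have "- y + x \<in> W"
        using sym_nhd_minus[OF W(1) xy] by (simp add: minus_add)
      then have "N (- x + y) < e" "N (- y + x) < e"
        using W(2) xy by auto
      then show ?thesis
        using f_step[of x y] f_step[of y x] by (simp add: dist_real_def)
    qed
    then have "\<forall>\<^sub>F z in principal {(x, y). - x + y \<in> W}.
        (case z of (x, y) \<Rightarrow> (f x, f y)) \<in> {(x, y). dist x y < e}"
      by (auto simp: eventually_principal)
    with left_uniformity_le[OF sym_nhd_eventually[OF W(1)]]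
    show "\<forall>\<^sub>F z in left_uniformity. (case z of (x, y) \<Rightarrow> (f x, f y)) \<in> {(x, y). dist x y < e}"
      by (rule filter_leD)
  qed
  ultimately have "right_uniformly_continuous f"
    using assms(1) by (simp add: FSIN_def)
  then have "\<forall>\<^sub>F z in right_uniformity. (case z of (x, y) \<Rightarrow> (f x, f y)) \<in> {(x, y). dist x y < 1/2}"
    unfolding right_uniformly_continuous_def uniformity_dist filterlim_INF filterlim_principal
    by (rule bspec) simp
  then obtain V where V: "sym_nhd V" "\<And>x y. x + (- y) \<in> V \<Longrightarrow> dist (f x) (f y) < 1/2"
    using eventually_right_uniformityD[where P = "\<lambda>z. (case z of (x, y) \<Rightarrow> (f x, f y)) \<in> {(x, y). dist x y < 1/2}"]
    by (metis (mono_tags, lifting) case_prodD case_prod_conv mem_Collect_eq)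
  have "\<exists>a'\<in>A. - a' + v + a \<in> U" if "v \<in> V" "a \<in> A" for v a
  proof -
    have "f a \<le> 0"
      using f_le[OF that(2), of a] N0 by simp
    moreover have "dist (f (v + a)) (f a) < 1/2"
      using that(1) by (intro V(2)) (simp add: add.assoc del: add_uminus_conv_diff)
    ultimately have "f (v + a) < 1/2"
      unfolding dist_real_def by linarith
    then obtain a' where "a' \<in> A" "N (- a' + (v + a)) < 1/2"
      unfolding f_def cINF_less_iff[OF False bdd] by blast
    then show ?thesis
      using N(4) by (auto simp: add.assoc)
  qed
  with V(1) show thesis
    by (rule that)
qed

text \<open>For \<open>M = L\<close> these are basic entourages of the Roelcke uniformity, the
  finest one coarser than the left and the right uniformity. The two sides are kept apart because
  they are used at different scales.\<close>

definition roelcke_near :: "'a::topological_group_add set \<Rightarrow> 'a set \<Rightarrow> 'a \<Rightarrow> 'a \<Rightarrow> bool" where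
  "roelcke_near M L x y \<longleftrightarrow> (\<exists>m\<in>M. \<exists>l\<in>L. y = m + x + l)"

lemma roelcke_near_refl: "sym_nhd M \<Longrightarrow> sym_nhd L \<Longrightarrow> roelcke_near M L x x"
  unfolding roelcke_near_def by (intro bexI[of _ 0]) (auto simp: sym_nhd_zero)

lemma roelcke_near_sym:
  assumes "sym_nhd M" "sym_nhd L" "roelcke_near M L x y"
  shows "roelcke_near M L y x"
proof -
  obtain m l where "m \<in> M" "l \<in> L" "y = m + x + l"
    using assms(3) unfolding roelcke_near_def by blast
  then have "- m \<in> M" "- l \<in> L" "x = - m + y + - l"
    using assms sym_nhd_minus by (auto simp: add.assoc simp del: add_uminus_conv_diff)
  then show ?thesis
    unfolding roelcke_near_def by blast
qed

lemma exists_maximal_roelcke_separated: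
  assumes "sym_nhd M" "sym_nhd L"
  obtains S where "\<And>x y. x \<in> S \<Longrightarrow> y \<in> S \<Longrightarrow> roelcke_near M L x y \<Longrightarrow> x = y"
    "\<And>y. \<exists>x\<in>S. roelcke_near M L x y"
  using exists_maximal_separated[of "roelcke_near M L"]
    roelcke_near_refl[OF assms] roelcke_near_sym[OF assms] by metis

text \<open>Absorption sends \<open>v + s\<close> to within \<open>U \<inter> L\<close> of some
  \<open>s'\<close> in \<open>S\<close>. Then \<open>s'\<close> lies in \<open>M + s + L\<close>, so
  separation gives \<open>s' = s\<close>.\<close>

lemma FSIN_roelcke_separated_thin:
  fixes S U :: "'a::topological_group_add set"
  assumes "FSIN TYPE('a)" and sym: "sym_nhd M" "sym_nhd L"
    and sep: "\<And>x y. x \<in> S \<Longrightarrow> y \<in> S \<Longrightarrow> roelcke_near M L x y \<Longrightarrow> x = y"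
    and U: "\<forall>\<^sub>F x in nhds 0. x \<in> U"
  obtains V where "sym_nhd V" "V \<subseteq> M" "\<And>v s. v \<in> V \<Longrightarrow> s \<in> S \<Longrightarrow> - s + v + s \<in> U"
proof -
  have "\<forall>\<^sub>F x in nhds 0. x \<in> U \<inter> L"
    using U sym_nhd_eventually[OF sym(2)] by (simp add: eventually_conj)
  then obtain V where V: "sym_nhd V"
    "\<And>v a. v \<in> V \<Longrightarrow> a \<in> S \<Longrightarrow> \<exists>a'\<in>S. - a' + v + a \<in> U \<inter> L"
    using FSIN_absorption[OF assms(1)] by metis
  have "- s + v + s \<in> U" if v: "v \<in> V \<inter> M" and s: "s \<in> S" for v s
  proof -
    obtain s' where s': "s' \<in> S" "- s' + v + s \<in> U \<inter> L"
      using V(2) v s by blast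
    have "s' = v + s + - (- s' + v + s)"
      by (simp add: minus_add add.assoc del: add_uminus_conv_diff)
    moreover have "- (- s' + v + s) \<in> L"
      using s' sym_nhd_minus[OF sym(2)] by blast
    ultimately have "roelcke_near M L s s'"
      using v unfolding roelcke_near_def by blast
    then show ?thesis
      using sep[OF s s'(1)] s'(2) by simp
  qed
  then show thesis
    using that[of "V \<inter> M"] sym_nhd_Int[OF V(1) sym(1)] by blast
qed

text \<open>Passage from codes \<open>b\<close>, \<open>b'\<close> to the elements \<open>x\<close>,
  \<open>x'\<close> near \<open>b + e\<close>, \<open>b' + e\<close>: the error made at the codes
  only has to stay small after conjugation by \<open>e\<close>.\<close>

lemma near_translate:
  fixes W :: "'a::topological_group_add set"
  assumes "sym_nhd W" "\<And>x y z. x \<in> W \<Longrightarrow> y \<in> W \<Longrightarrow> z \<in> W \<Longrightarrow> x + y + z \<in> U"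
    and "- x + b + e \<in> W" "- x' + b' + e \<in> W" "- e + (- b' + v + b) + e \<in> W"
  shows "- x' + v + x \<in> U"
proof -
  have "- x' + v + x = (- x' + b' + e) + (- e + (- b' + v + b) + e) + - (- x + b + e)"
    by (simp add: minus_add add.assoc del: add_uminus_conv_diff)
  then show ?thesis
    using assms sym_nhd_minus by metis
qed

section \<open>Pairs\<close>

text \<open>
  A pair \<open>(x, y)\<close> is encoded by a single element \<open>b\<close> such that \<open>x\<close> is close to \<open>b + e c\<close> and \<open>y\<close> is
  close to \<open>b + f c\<close>, the index \<open>c\<close> being recoverable from \<open>b\<close>.
\<close>

lemma absorption_pairs_by_codes:
  fixes R :: "('a::topological_group_add \<times> 'a) set" and e f :: "'c \<Rightarrow> 'a" and \<Gamma> :: "'c \<Rightarrow> 'a set"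
  assumes W: "sym_nhd W" "\<And>x y z. x \<in> W \<Longrightarrow> y \<in> W \<Longrightarrow> z \<in> W \<Longrightarrow> x + y + z \<in> U"
    and K: "\<And>c k. c \<in> C \<Longrightarrow> k \<in> K \<Longrightarrow> - e c + k + e c \<in> W"
      "\<And>c k. c \<in> C \<Longrightarrow> k \<in> K \<Longrightarrow> - f c + k + f c \<in> W"
    and absorb: "\<And>\<Lambda>. (\<And>c. c \<in> C \<Longrightarrow> \<Lambda> c \<subseteq> \<Gamma> c) \<Longrightarrow>
      \<exists>V. sym_nhd V \<and> (\<forall>c\<in>C. \<forall>v\<in>V. \<forall>b\<in>\<Lambda> c. \<exists>b'\<in>\<Lambda> c. - b' + v + b \<in> K)"
    and code: "\<And>x y. \<exists>c\<in>C. \<exists>b\<in>\<Gamma> c. - x + b + e c \<in> W \<and> - y + b + f c \<in> W"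
  shows "\<exists>V. sym_nhd V \<and>
    (\<forall>v\<in>V. \<forall>(x, y)\<in>R. \<exists>(x', y')\<in>R. - x' + v + x \<in> U \<and> - y' + v + y \<in> U)"
proof -
  \<comment> \<open>The codes with index \<open>c\<close> of pairs in \<open>R\<close>. Absorbing
    within one \<open>\<Lambda> c\<close> keeps the offsets \<open>e c\<close> and
    \<open>f c\<close>, and the new code decodes to a pair of \<open>R\<close> again.\<close>
  define \<Lambda> where "\<Lambda> c = {b \<in> \<Gamma> c. \<exists>(x, y)\<in>R. - x + b + e c \<in> W \<and> - y + b + f c \<in> W}" for c
  obtain V where V: "sym_nhd V"
    "\<And>c v b. c \<in> C \<Longrightarrow> v \<in> V \<Longrightarrow> b \<in> \<Lambda> c \<Longrightarrow> \<exists>b'\<in>\<Lambda> c. - b' + v + b \<in> K"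
    using absorb[of \<Lambda>] by (auto simp: \<Lambda>_def)
  have "\<exists>(x', y')\<in>R. - x' + v + x \<in> U \<and> - y' + v + y \<in> U" if v: "v \<in> V" and R: "(x, y) \<in> R" for v x y
  proof -
    obtain c b where c: "c \<in> C" "b \<in> \<Gamma> c" "- x + b + e c \<in> W" "- y + b + f c \<in> W"
      using code by blast
    then have "b \<in> \<Lambda> c"
      using R unfolding \<Lambda>_def by blast
    then obtain b' where b': "b' \<in> \<Lambda> c" "- b' + v + b \<in> K"
      using V(2) c(1) v by blast
    then obtain x' y' where R': "(x', y') \<in> R" "- x' + b' + e c \<in> W" "- y' + b' + f c \<in> W"
      unfolding \<Lambda>_def by blast
    have "- x' + v + x \<in> U" "- y' + v + y \<in> U"
      using near_translate[OF W] c R' K[OF c(1) b'(2)] by blast+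
    then show ?thesis
      using R'(1) by blast
  qed
  then show ?thesis
    using V(1) by blast
qed

lemma exists_minim_card_of:
  assumes "X \<in> \<Q>"
  obtains Q where "Q \<in> \<Q>" "\<And>Q'. Q' \<in> \<Q> \<Longrightarrow> |Q| \<le>o |Q'|"
proof -
  have "\<exists>r\<in>card_of ` \<Q>. \<forall>r'\<in>card_of ` \<Q>. r \<le>o r'"
    using assms by (intro exists_minim_Card_order) (auto simp: card_of_Card_order)
  then show thesis
    using that by auto
qed

lemma FSIN_absorption_pairs:
  fixes R :: "('a::topological_group_add \<times> 'a) set"
  assumes fsin: "FSIN TYPE('a)" and U: "\<forall>\<^sub>F x in nhds 0. x \<in> U"
  shows "\<exists>V. sym_nhd V \<and>
    (\<forall>v\<in>V. \<forall>(x, y)\<in>R. \<exists>(x', y')\<in>R. - x' + v + x \<in> U \<and> - y' + v + y \<in> U)"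
proof -
  obtain W2 where W2: "sym_nhd W2" "\<And>x y z. x \<in> W2 \<Longrightarrow> y \<in> W2 \<Longrightarrow> z \<in> W2 \<Longrightarrow> x + y + z \<in> U"
    using sym_nhd_third[OF U] by metis
  obtain W where W: "sym_nhd W" "W \<subseteq> W2" "\<And>x y. x \<in> W \<Longrightarrow> y \<in> W \<Longrightarrow> x + y \<in> W2"
    using sym_nhd_half[OF sym_nhd_eventually[OF W2(1)]] by metis
  obtain T where T: "\<And>x y. x \<in> T \<Longrightarrow> y \<in> T \<Longrightarrow> roelcke_near W W x y \<Longrightarrow> x = y"
    "\<And>y. \<exists>x\<in>T. roelcke_near W W x y"
    using exists_maximal_roelcke_separated[OF W(1) W(1)] by metis
  obtain L where L: "sym_nhd L" "L \<subseteq> W" "\<And>l t. l \<in> L \<Longrightarrow> t \<in> T \<Longrightarrow> - t + l + t \<in> W"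
    using FSIN_roelcke_separated_thin[OF fsin W(1) W(1) _ sym_nhd_eventually[OF W(1)], of T] T(1) by metis
  have T_diff: "\<exists>w\<in>W. \<exists>t\<in>T. \<exists>w'\<in>W. - x + y = w + t + w'" for x y
    using T(2) unfolding roelcke_near_def by blast
  show ?thesis
  proof (cases "finite T")
    case True
    show ?thesis
    proof (rule absorption_pairs_by_codes[where C = T and K = L and e = "\<lambda>_. 0" and f = "\<lambda>t. t"
          and \<Gamma> = "\<lambda>_. UNIV", OF W2])
      show "- 0 + k + 0 \<in> W2" "- t + k + t \<in> W2" if "t \<in> T" "k \<in> L" for t k
        using that L W(2) by auto
      show "\<exists>t\<in>T. \<exists>b\<in>UNIV. - x + b + 0 \<in> W2 \<and> - y + b + t \<in> W2" for x y
      proof -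
        obtain w t w' where *: "w \<in> W" "t \<in> T" "w' \<in> W" "- x + y = w + t + w'"
          using T_diff by blast
        have "y = x + (w + t + w')"
          by (simp flip: *(4) add: add.assoc[symmetric])
        then have "- y + (x + w) + t = - w'"
          by (simp add: minus_add add.assoc del: add_uminus_conv_diff)
        moreover have "- x + (x + w) + 0 = w"
          by (simp add: add.assoc[symmetric])
        ultimately show ?thesis
          using * W sym_nhd_minus[OF W(1)] by (metis UNIV_I subsetD)
      qed
      \<comment> \<open>With finitely many indices the index need not be recovered from the code:
        one neighbourhood per \<open>t\<close> is found, and these are intersected.\<close>
      show "\<exists>V. sym_nhd V \<and> (\<forall>t\<in>T. \<forall>v\<in>V. \<forall>b\<in>\<Lambda> t. \<exists>b'\<in>\<Lambda> t. - b' + v + b \<in> L)" for \<Lambda>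
      proof -
        have "\<forall>t. \<exists>V. sym_nhd V \<and> (\<forall>v\<in>V. \<forall>b\<in>\<Lambda> t. \<exists>b'\<in>\<Lambda> t. - b' + v + b \<in> L)"
          using FSIN_absorption[OF fsin sym_nhd_eventually[OF L(1)]] by metis
        then obtain V where "\<And>t. sym_nhd (V t)"
          "\<And>t v b. v \<in> V t \<Longrightarrow> b \<in> \<Lambda> t \<Longrightarrow> \<exists>b'\<in>\<Lambda> t. - b' + v + b \<in> L"
          by metis
        then show ?thesis
          using sym_nhd_INT[OF True, of V] by (intro exI[of _ "\<Inter>t\<in>T. V t"]) auto
      qed
    qed
  next
    case False
    obtain L0 where L0: "sym_nhd L0" "L0 \<subseteq> L" "\<And>x y. x \<in> L0 \<Longrightarrow> y \<in> L0 \<Longrightarrow> x + y \<in> L"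
      using sym_nhd_half[OF sym_nhd_eventually[OF L(1)]] by metis
    obtain V where V: "sym_nhd V" "V \<subseteq> L0" "\<And>x y. x \<in> V \<Longrightarrow> y \<in> V \<Longrightarrow> x + y \<in> L0"
      "\<And>x y z. x \<in> V \<Longrightarrow> y \<in> V \<Longrightarrow> z \<in> V \<Longrightarrow> x + y + z \<in> L0"
      using sym_nhd_third[OF sym_nhd_eventually[OF L0(1)]] by metis
    obtain M where M: "sym_nhd M" "M \<subseteq> V" "\<And>x y. x \<in> M \<Longrightarrow> y \<in> M \<Longrightarrow> x + y \<in> V"
      using sym_nhd_half[OF sym_nhd_eventually[OF V(1)]] by metis
    \<comment> \<open>\<open>V\<close> and \<open>L0\<close> change sides when a covering is inverted, so the nesting \<open>M \<subseteq> V \<subseteq> L0\<close> makes the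
      covering number at the finer scale at least the one at the coarser scale.\<close>
    define \<Q> where "\<Q> = {Q. \<forall>g. \<exists>q\<in>Q. roelcke_near V L0 q g}"
    have "UNIV \<in> \<Q>"
      using roelcke_near_refl[OF V(1) L0(1)] unfolding \<Q>_def by blast
    then obtain Q where Q: "Q \<in> \<Q>" and Q_min: "\<And>Q'. Q' \<in> \<Q> \<Longrightarrow> |Q| \<le>o |Q'|"
      using exists_minim_card_of by metis
    \<comment> \<open>Two elements of \<open>T\<close> near the same point of \<open>Q\<close> are
      near each other at scale \<open>W\<close>, hence equal.\<close>
    have "|T| \<le>o |Q|"
    proof -
      have "\<forall>t. \<exists>q. q \<in> Q \<and> roelcke_near V L0 q t"
        using Q unfolding \<Q>_def by blast
      then obtain h where h: "\<And>t. h t \<in> Q" "\<And>t. roelcke_near V L0 (h t) t"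
        by metis
      have "inj_on h T"
      proof (rule inj_onI)
        fix t t' assume t: "t \<in> T" "t' \<in> T" "h t = h t'"
        obtain p l p' l' where *: "p \<in> V" "l \<in> L0" "t = p + h t + l" "p' \<in> V" "l' \<in> L0" "t' = p' + h t + l'"
          using h(2)[of t] h(2)[of t'] t(3) unfolding roelcke_near_def by metis
        have "t' = (p' + - p) + (p + h t + l) + (- l + l')"
          by (subst *(6)) (simp add: add.assoc del: add_uminus_conv_diff)
        then have "t' = (p' + - p) + t + (- l + l')"
          using *(3) by simp
        moreover have "p' + - p \<in> L0"
          by (rule V(3)) (use * sym_nhd_minus[OF V(1)] in blast)+
        then have "p' + - p \<in> W"
          using L0(2) L(2) by blast
        moreover have "- l + l' \<in> L"
          by (rule L0(3)) (use * sym_nhd_minus[OF L0(1)] in blast)+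
        then have "- l + l' \<in> W"
          using L(2) by blast
        ultimately have "roelcke_near W W t t'"
          unfolding roelcke_near_def by blast
        then show "t = t'"
          using T(1) t by blast
      qed
      then show ?thesis
        using h(1) by (intro card_of_ordLeq[THEN iffD1]) blast
    qed
    moreover from this have "infinite Q"
      using False card_of_ordLeq_finite by blast
    moreover have "T \<noteq> {}"
      using False by auto
    \<comment> \<open>Thus a recursion indexed by \<open>Q \<times> T\<close> has at every stage
      fewer than \<open>|Q|\<close> elements to avoid, although each \<open>q\<close> is used once
      for every \<open>t\<close>.\<close>
    ultimately have QT: "|Q \<times> T| =o |Q|"
      by (intro card_of_Times_infinite[THEN conjunct1])
    obtain S where S: "\<And>x y. x \<in> S \<Longrightarrow> y \<in> S \<Longrightarrow> roelcke_near M L0 x y \<Longrightarrow> x = y"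
      "\<And>y. \<exists>x\<in>S. roelcke_near M L0 x y"
      using exists_maximal_roelcke_separated[OF M(1) L0(1)] by metis
    obtain K where K: "sym_nhd K" "K \<subseteq> M" "\<And>k s. k \<in> K \<Longrightarrow> s \<in> S \<Longrightarrow> - s + k + s \<in> L0"
      using FSIN_roelcke_separated_thin[OF fsin M(1) L0(1) _ sym_nhd_eventually[OF L0(1)], of S] S(1) by metis
    \<comment> \<open>If fewer than \<open>|Q|\<close> translates \<open>L0 + b + K\<close> covered \<open>opt (q, t)\<close>, the sets \<open>V + (- b) + L0\<close> would
      cover the group, because \<open>M + S + L0\<close> is everything and \<open>M - K \<subseteq> V\<close>; this contradicts the
      minimality of \<open>Q\<close>.\<close>
    define opt where "opt c = {fst c + l + - s | l s. l \<in> L0 \<and> s \<in> S}" for c :: "'a \<times> 'a"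
    have avail: "\<exists>b\<in>opt c. \<forall>a\<in>B. \<not> roelcke_near L0 K a b"
      if B: "|B| <o |Q \<times> T|" for c :: "'a \<times> 'a" and B
    proof (rule ccontr)
      assume contra: "\<not> ?thesis"
      have "uminus ` B \<in> \<Q>"
        unfolding \<Q>_def
      proof (intro CollectI allI)
        fix g
        obtain s m l where s: "s \<in> S" "m \<in> M" "l \<in> L0" "g + fst c = m + s + l"
          using S(2)[of "g + fst c"] unfolding roelcke_near_def by blast
        have "fst c = - g + (m + s + l)"
          by (simp flip: s(4) add: add.assoc[symmetric])
        then have "fst c + - l + - s = - g + m"
          by (simp add: add.assoc del: add_uminus_conv_diff)
        then have "- g + m \<in> opt c"
          unfolding opt_def using s sym_nhd_minus[OF L0(1) s(3)] by force
        then obtain a where a: "a \<in> B" "roelcke_near L0 K a (- g + m)"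
          using contra by blast
        then obtain p k where pk: "p \<in> L0" "k \<in> K" "- g + m = p + a + k"
          unfolding roelcke_near_def by blast
        have "g = m + - (- g + m)"
          by (simp add: minus_add add.assoc[symmetric])
        then have "g = (m + - k) + - a + - p"
          unfolding pk(3) by (simp add: minus_add add.assoc del: add_uminus_conv_diff)
        moreover have "m + - k \<in> V"
          by (rule M(3)) (use s pk K sym_nhd_minus[OF K(1)] in blast)+
        moreover have "- p \<in> L0"
          by (rule sym_nhd_minus[OF L0(1) pk(1)])
        ultimately show "\<exists>q\<in>uminus ` B. roelcke_near V L0 q g"
          using a(1) unfolding roelcke_near_def by blast
      qed
      then have "|Q| \<le>o |uminus ` B|"
        by (rule Q_min)
      then have "|Q| \<le>o |B|"
        using card_of_image ordLeq_transitive by blast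
      moreover have "|B| <o |Q|"
        using B QT by (rule ordLess_ordIso_trans)
      ultimately show False
        using not_ordLess_ordLeq by blast
    qed
    have "\<exists>\<beta>. (\<forall>c\<in>Q \<times> T. \<beta> c \<in> opt c) \<and>
        (\<forall>c\<in>Q \<times> T. \<forall>c'\<in>Q \<times> T. roelcke_near L0 K (\<beta> c) (\<beta> c') \<longrightarrow> c = c')"
      by (rule greedy_separated_choice[of "roelcke_near L0 K" "Q \<times> T" opt,
            OF roelcke_near_sym[OF L0(1) K(1)] avail]) blast+
    then obtain \<beta> where \<beta>: "\<And>c. c \<in> Q \<times> T \<Longrightarrow> \<beta> c \<in> opt c"
      "\<And>c c'. c \<in> Q \<times> T \<Longrightarrow> c' \<in> Q \<times> T \<Longrightarrow> roelcke_near L0 K (\<beta> c) (\<beta> c') \<Longrightarrow> c = c'"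
      by metis
    have "\<forall>c. \<exists>l s. c \<in> Q \<times> T \<longrightarrow> l \<in> L0 \<and> s \<in> S \<and> \<beta> c = fst c + l + - s"
      using \<beta>(1) unfolding opt_def by blast
    then obtain l s where ls: "\<And>c. c \<in> Q \<times> T \<Longrightarrow> l c \<in> L0" "\<And>c. c \<in> Q \<times> T \<Longrightarrow> s c \<in> S"
      "\<And>c. c \<in> Q \<times> T \<Longrightarrow> \<beta> c = fst c + l c + - s c"
      by metis
    show ?thesis
    \<comment> \<open>Since \<open>\<beta> c + s c\<close> is \<open>fst c + l c\<close>, the offset
      \<open>s c\<close> leads from the code back near a point of the net \<open>Q\<close>; the
      further offset \<open>snd c\<close> leads to the second coordinate.\<close>
    proof (rule absorption_pairs_by_codes[where C = "Q \<times> T" and K = K and e = s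
          and f = "\<lambda>c. s c + snd c" and \<Gamma> = "\<lambda>c. (\<lambda>p. p + \<beta> c) ` V", OF W2])
      show "- s c + k + s c \<in> W2" if "c \<in> Q \<times> T" "k \<in> K" for c k
        using K(3)[OF that(2) ls(2)[OF that(1)]] L0(2) L(2) W(2) by blast
      \<comment> \<open>Conjugation in two stages: by \<open>s c\<close> from \<open>K\<close> into
        \<open>L0\<close>, then by an element of \<open>T\<close> from \<open>L\<close> into
        \<open>W\<close>.\<close>
      show "- (s c + snd c) + k + (s c + snd c) \<in> W2" if "c \<in> Q \<times> T" "k \<in> K" for c k
      proof -
        have "- snd c + (- s c + k + s c) + snd c \<in> W"
          using K(3)[OF that(2) ls(2)[OF that(1)]] L0(2) L(3) that by force
        moreover have "- (s c + snd c) + k + (s c + snd c) = - snd c + (- s c + k + s c) + snd c"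
          by (simp add: minus_add add.assoc del: add_uminus_conv_diff)
        ultimately show ?thesis
          using W(2) by auto
      qed
      show "\<exists>c\<in>Q \<times> T. \<exists>b\<in>(\<lambda>p. p + \<beta> c) ` V. - x + b + s c \<in> W2 \<and> - y + b + (s c + snd c) \<in> W2" for x y
      proof -
        obtain w t w' where *: "w \<in> W" "t \<in> T" "w' \<in> W" "- x + y = w + t + w'"
          using T_diff by blast
        obtain q p l' where q: "q \<in> Q" "p \<in> V" "l' \<in> L0" "x + w = p + q + l'"
          using Q unfolding \<Q>_def roelcke_near_def by blast
        let ?c = "(q, t)"
        have c: "?c \<in> Q \<times> T"
          using q * by simp
        \<comment> \<open>The right-hand error between \<open>x + w\<close> and
          \<open>p + \<beta> ?c + s ?c\<close>. It lies in \<open>L\<close>, so it stays small even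
          after conjugation by \<open>t\<close>.\<close>
        define d where "d = - l' + l ?c"
        have d: "d \<in> L"
          unfolding d_def by (rule L0(3)) (use sym_nhd_minus[OF L0(1) q(3)] ls(1)[OF c] in auto)
        have "p + q = x + w + - l'"
          unfolding q(4) by (simp add: add.assoc del: add_uminus_conv_diff)
        then have b: "p + \<beta> ?c = x + w + d + - s ?c"
          unfolding ls(3)[OF c] d_def by (simp add: add.assoc[symmetric] del: add_uminus_conv_diff)
        have y: "y = x + (w + t + w')"
          by (simp flip: *(4) add: add.assoc[symmetric])
        have "- x + (p + \<beta> ?c) + s ?c = w + d"
          unfolding b by (simp add: add.assoc del: add_uminus_conv_diff)
        moreover have "w + d \<in> W2"
          using W(3) *(1) d L(2) by blast
        moreover have "- y + (p + \<beta> ?c) + (s ?c + snd ?c) = - w' + (- t + d + t)"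
          unfolding b y by (simp add: minus_add add.assoc del: add_uminus_conv_diff)
        moreover have "- w' + (- t + d + t) \<in> W2"
          using W(3) sym_nhd_minus[OF W(1) *(3)] L(3)[OF d *(2)] by blast
        ultimately show ?thesis
          using c q(2) by (intro bexI[of _ ?c] bexI[of _ "p + \<beta> ?c"]) auto
      qed
      show "\<exists>V. sym_nhd V \<and> (\<forall>c\<in>Q \<times> T. \<forall>v\<in>V. \<forall>b\<in>\<Lambda> c. \<exists>b'\<in>\<Lambda> c. - b' + v + b \<in> K)"
        if \<Lambda>: "\<And>c. c \<in> Q \<times> T \<Longrightarrow> \<Lambda> c \<subseteq> (\<lambda>p. p + \<beta> c) ` V" for \<Lambda>
      proof -
        \<comment> \<open>Absorption is applied once, to the union over all indices, so
          \<open>V1\<close> does not depend on \<open>c\<close>. The code \<open>b'\<close> found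
          could belong to another index \<open>c'\<close>, but \<open>\<beta> c\<close> and
          \<open>\<beta> c'\<close> would then be near, which forces \<open>c' = c\<close>.\<close>
        obtain V1 where V1: "sym_nhd V1"
          "\<And>v b. v \<in> V1 \<Longrightarrow> b \<in> (\<Union>c\<in>Q \<times> T. \<Lambda> c) \<Longrightarrow> \<exists>b'\<in>(\<Union>c\<in>Q \<times> T. \<Lambda> c). - b' + v + b \<in> K"
          using FSIN_absorption[OF fsin sym_nhd_eventually[OF K(1)]] by metis
        have "\<exists>b'\<in>\<Lambda> c. - b' + v + b \<in> K" if c: "c \<in> Q \<times> T" and v: "v \<in> V1 \<inter> V" and b: "b \<in> \<Lambda> c" for c v b
        proof -
          obtain c' b' where b': "c' \<in> Q \<times> T" "b' \<in> \<Lambda> c'" "- b' + v + b \<in> K"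
            using V1(2)[of v b] c v b by blast
          obtain p p' where p: "p \<in> V" "b = p + \<beta> c" "p' \<in> V" "b' = p' + \<beta> c'"
            using \<Lambda>[OF c] \<Lambda>[OF b'(1)] b b'(2) by blast
          have "\<beta> c' = (- p' + v + p) + \<beta> c + - (- b' + v + b)"
            unfolding p(2,4) by (simp add: minus_add add.assoc del: add_uminus_conv_diff)
          moreover have "- p' + v + p \<in> L0"
            by (rule V(4)) (use p v sym_nhd_minus[OF V(1)] in auto)
          moreover have "- (- b' + v + b) \<in> K"
            by (rule sym_nhd_minus[OF K(1) b'(3)])
          ultimately have "roelcke_near L0 K (\<beta> c) (\<beta> c')"
            unfolding roelcke_near_def by blast
          then have "c = c'"
            using \<beta>(2) c b'(1) by blast
          then show ?thesis
            using b' by blast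
        qed
        then show ?thesis
          using sym_nhd_Int[OF V1(1) V(1)] by blast
      qed
    qed
  qed
qed

section \<open>The theorem\<close>

lemma FSIN_imp_conjugates_small:
  fixes U :: "'a::topological_group_add set"
  assumes fsin: "FSIN TYPE('a)" and U: "\<forall>\<^sub>F x in nhds 0. x \<in> U"
  shows "\<exists>V. sym_nhd V \<and> (\<forall>v\<in>V. \<forall>x. - x + v + x \<in> U)"
proof -
  obtain U1 where U1: "sym_nhd U1" "\<And>x y z. x \<in> U1 \<Longrightarrow> y \<in> U1 \<Longrightarrow> z \<in> U1 \<Longrightarrow> x + y + z \<in> U"
    using sym_nhd_third[OF U] by metis
  obtain U2 where U2: "sym_nhd U2" "U2 \<subseteq> U1" "\<And>x y. x \<in> U2 \<Longrightarrow> y \<in> U2 \<Longrightarrow> x + y \<in> U1"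
    using sym_nhd_half[OF sym_nhd_eventually[OF U1(1)]] by metis
  have "- x + x \<in> U1" "- x + y \<in> U1 \<Longrightarrow> - y + x \<in> U1" for x y
    using sym_nhd_zero[OF U1(1)] sym_nhd_minus[OF U1(1), of "- x + y"] by (simp_all add: minus_add)
  then obtain D where D: "\<And>x y. x \<in> D \<Longrightarrow> y \<in> D \<Longrightarrow> - x + y \<in> U1 \<Longrightarrow> x = y"
    "\<And>y. \<exists>x\<in>D. - x + y \<in> U1"
    using exists_maximal_separated[of "\<lambda>x y. - x + y \<in> U1"] by metis
  define r where "r = card_of D"
  have wo: "well_order_on D r"
    unfolding r_def by (rule card_of_well_order_on)
  have r_D: "x \<in> D" "y \<in> D" if "(x, y) \<in> r" for x y
    using wo that well_order_on_domain by fastforce+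
  have r_total: "(y, x) \<in> r" if "(x, y) \<notin> r" "x \<in> D" "y \<in> D" for x y
    using wo that by (cases "x = y") (auto simp: well_order_on_def linear_order_on_def total_on_def
        partial_order_on_def preorder_on_def refl_on_def)
  have r_antisym: "x = y" if "(x, y) \<in> r" "(y, x) \<in> r" for x y
    using wo that by (auto simp: well_order_on_def linear_order_on_def partial_order_on_def antisym_def)
  \<comment> \<open>The well-order itself serves as the set of pairs: up to \<open>U2\<close>, each
    \<open>v\<close> moves comparable pairs of \<open>D\<close> to comparable pairs.\<close>
  obtain V where V: "sym_nhd V" "\<And>v x y. v \<in> V \<Longrightarrow> (x, y) \<in> r \<Longrightarrow>
      \<exists>(x', y')\<in>r. - x' + v + x \<in> U2 \<and> - y' + v + y \<in> U2"
    using FSIN_absorption_pairs[OF fsin sym_nhd_eventually[OF U2(1)], of r] by blast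
  \<comment> \<open>This and \<open>preimage_unique\<close> say that, up to \<open>U2\<close>,
    translation by \<open>v\<close> is a partial injection of \<open>D\<close>.\<close>
  have image_unique: "x' = x''"
    if "x' \<in> D" "x'' \<in> D" "- x' + v + x \<in> U2" "- x'' + v + x \<in> U2" for x' x'' v x
  proof (rule D(1))
    have "(- x' + v + x) + - (- x'' + v + x) \<in> U1"
      using that sym_nhd_minus[OF U2(1)] by (intro U2(3)) auto
    then show "- x' + x'' \<in> U1"
      by (simp add: minus_add add.assoc del: add_uminus_conv_diff)
  qed (use that in auto)
  have preimage_unique: "x = y"
    if "x \<in> D" "y \<in> D" "- x' + v + x \<in> U2" "- x' + v + y \<in> U2" for x' v x y
  proof (rule D(1))
    have "- (- x' + v + x) + (- x' + v + y) \<in> U1"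
      using that sym_nhd_minus[OF U2(1)] by (intro U2(3)) auto
    then show "- x + y \<in> U1"
      by (simp add: minus_add add.assoc del: add_uminus_conv_diff)
  qed (use that in auto)
  have wf: "wf (r - Id)"
    using wo by (simp add: well_order_on_def)
  \<comment> \<open>An injective order-preserving map of a well-order never decreases. If
    \<open>x'\<close> were below \<open>x\<close>, the pair \<open>(x', x)\<close> would move to
    some \<open>(y1, y2)\<close> with \<open>y2 = x'\<close>; induction gives
    \<open>x' \<le> y1 \<le> y2\<close>, so \<open>x'\<close> and \<open>x\<close> would have the
    same image.\<close>
  have increasing: "(x, x') \<in> r" if "v \<in> V" "x \<in> D" "x' \<in> D" "- x' + v + x \<in> U2" for v x x'
    using wf that(2-)
  proof (induction x arbitrary: x' rule: wf_induct_rule)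
    case (less x)
    show ?case
    proof (rule ccontr)
      assume not_le: "(x, x') \<notin> r"
      then have lt: "(x', x) \<in> r"
        using r_total less.prems by blast
      obtain y1 y2 where y: "(y1, y2) \<in> r" "- y1 + v + x' \<in> U2" "- y2 + v + x \<in> U2"
        using V(2)[OF \<open>v \<in> V\<close> lt] by blast
      have "y2 = x'"
        using image_unique r_D(2)[OF y(1)] y(3) less.prems by blast
      moreover have "(x', y1) \<in> r"
        using less.IH[of x' y1] lt not_le r_D[OF y(1)] y(2) less.prems by blast
      ultimately have "y1 = x'"
        using y(1) r_antisym by blast
      then have "x = x'"
        using preimage_unique[of x x' x' v] y(2) less.prems by blast
      then show False
        using not_le lt by blast
    qed
  qed
  have fixed: "- d + v + d \<in> U2" if v: "v \<in> V" and d: "d \<in> D" for v d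
  proof -
    have "(d, d) \<in> r"
      using r_total d by blast
    then obtain d' where d': "d' \<in> D" "- d' + v + d \<in> U2"
      using V(2)[OF v] r_D by blast
    \<comment> \<open>The inverse \<open>- v\<close> moves \<open>d'\<close> back to
      \<open>d\<close>, so \<open>increasing\<close> applies in both directions.\<close>
    have "- d + - v + d' \<in> U2"
      using sym_nhd_minus[OF U2(1) d'(2)] by (simp add: minus_add add.assoc del: add_uminus_conv_diff)
    then have "(d', d) \<in> r" "(d, d') \<in> r"
      using increasing[OF sym_nhd_minus[OF V(1) v] d'(1) d] increasing[OF v d d'] by blast+
    then show ?thesis
      using r_antisym d'(2) by blast
  qed
  have "- x + v + x \<in> U" if v: "v \<in> V" for v x
  proof -
    obtain d where d: "d \<in> D" "- d + x \<in> U1"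
      using D(2) by blast
    \<comment> \<open>Conjugation by \<open>x\<close> is conjugation by \<open>d\<close> followed by
      conjugation by the small element \<open>- d + x\<close>.\<close>
    have "- (- d + x) + (- d + v + d) + (- d + x) \<in> U"
      using U1(2) sym_nhd_minus[OF U1(1)] d fixed[OF v d(1)] U2(2) by blast
    then show ?thesis
      by (simp add: minus_add add.assoc del: add_uminus_conv_diff)
  qed
  then show ?thesis
    using V(1) by blast
qed

theorem corollary3p9:
  shows "(SIN TYPE('a::{topological_group_add, t2_space}) \<longleftrightarrow> SFSIN TYPE('a)) \<and>
         (SFSIN TYPE('a) \<longleftrightarrow> FSIN TYPE('a))"
proof -
  have "SIN TYPE('a) \<Longrightarrow> SFSIN TYPE('a)"
    by (simp add: SIN_def SFSIN_def left_uniformly_continuous_def right_uniformly_continuous_def)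
  moreover have "SFSIN TYPE('a) \<Longrightarrow> FSIN TYPE('a)"
    by (simp add: SFSIN_def FSIN_def)
  moreover have "FSIN TYPE('a) \<Longrightarrow> SIN TYPE('a)"
    by (intro SIN_if_conjugates_small FSIN_imp_conjugates_small)
  ultimately show ?thesis
    by blast
qed

end
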